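(* Let $(\Omega,\mathcal A,P)$ be a probability space, let $\mathcal F\subseteq\mathcal A$ be a sub-$\sigma$-algebra, and let $\{A_n, n\ge 1\}$ be a sequence of events in $\mathcal A$ that are conditionally independent given $\mathcal F$. Suppose that the sequence $\{\sum_{i=1}^n P(A_i\mid\mathcal F),\ n\ge1\}$ diverges almost surely with rate $\psi$, where $\psi=\{\psi(N),\ N\ge1\}$ is a (possibly random) function with values in the positive integers; that is, for all integers $N\ge 1$, $$\sum_{i=1}^{\psi(N)}P(A_i\mid\mathcal F)\ge N\quad\text{almost surely.}$$ Then, for all integers $n\ge 1$ and $N\ge 1$, $$P\Big(\bigcup_{i=n}^{\psi(n+N-1)}A_i\,\Big|\,\mathcal F\Big)\ge 1-e^{-N}\quad\text{almost surely.}$$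
   Context: $P(A\mid\mathcal F)=E[\mathbf 1_A\mid\mathcal F]$; for each of the countably many events involved a version of the conditional probability is fixed. The events $A_n$, $n\ge1$, are conditionally independent given $\mathcal F$ if for every finite set $I$ of positive integers, $P(\bigcap_{i\in I}A_i\mid\mathcal F)=\prod_{i\in I}P(A_i\mid\mathcal F)$ almost surely. "Possibly random" means that $\psi(N)$ may depend on $\omega\in\Omega$; expressions with a random index are evaluated pointwise: at $\omega$, $\sum_{i=1}^{\psi(N)}P(A_i\mid\mathcal F)$ means $\sum_{i=1}^{b}P(A_i\mid\mathcal F)(\omega)$ with $b=\psi(N)(\omega)$, and $P(\bigcup_{i=n}^{\psi(k)}A_i\mid\mathcal F)$ means $P(\bigcup_{i=n}^{b}A_i\mid\mathcal F)(\omega)$ with $b=\psi(k)(\omega)$. *)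

theory Defs
  imports "HOL-Probability.Probability"
begin

text \<open>
  A choice \<open>Q\<close> of versions of the conditional probabilities given \<open>F\<close>: for every event \<open>B\<close>, the
  function \<open>Q B\<close> is one version of \<open>P(B | F) = E[1\<^sub>B | F]\<close>. Conditional expectations are only
  determined up to null sets, and the choice matters once expressions are evaluated pointwise
  at a random index.
\<close>

definition cond_prob_versions :: "'a measure \<Rightarrow> 'a measure \<Rightarrow> ('a set \<Rightarrow> 'a \<Rightarrow> real) \<Rightarrow> bool" where
  "cond_prob_versions M F Q \<longleftrightarrow>
     (\<forall>B\<in>sets M. Q B \<in> borel_measurable F \<and>
        (AE \<omega> in M. Q B \<omega> = real_cond_exp M F (indicator B) \<omega>))"

text \<open>
  The intersection is taken inside \<open>space M\<close>, so that it is the sure event for \<open>I = {}\<close>.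
\<close>

definition cond_indep_events ::
  "'a measure \<Rightarrow> ('a set \<Rightarrow> 'a \<Rightarrow> real) \<Rightarrow> ('i \<Rightarrow> 'a set) \<Rightarrow> 'i set \<Rightarrow> bool" where
  "cond_indep_events M Q A J \<longleftrightarrow>
     (\<forall>I. finite I \<and> I \<subseteq> J \<longrightarrow>
        (AE \<omega> in M. Q (space M \<inter> (\<Inter>i\<in>I. A i)) \<omega> = (\<Prod>i\<in>I. Q (A i) \<omega>)))"

text \<open>
  The series \<open>X 1 + X 2 + \<dots>\<close> diverges almost surely with the possibly random rate \<open>\<psi>\<close>. No
  measurability of \<open>\<psi> N\<close> is required: almost surely means outside a set contained in a null set.
\<close>

definition AE_diverges_with_rate ::
  "'a measure \<Rightarrow> (nat \<Rightarrow> 'a \<Rightarrow> real) \<Rightarrow> (nat \<Rightarrow> 'a \<Rightarrow> nat) \<Rightarrow> bool" where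
  "AE_diverges_with_rate M X \<psi> \<longleftrightarrow>
     (\<forall>N\<ge>1. AE \<omega> in M. (\<Sum>i = 1..\<psi> N \<omega>. X i \<omega>) \<ge> real N)"

end

theory Submission
  imports Defs
begin

text \<open>
  For a fixed index \<open>b\<close>, conditional independence passes to the complements, so the conditional
  probability that none of \<open>A n, \<dots>, A b\<close> occurs is \<open>\<Prod>(1 - P(A i | F)) \<le> exp (- \<Sum>P(A i | F))\<close>.
  Only countably many indices \<open>b\<close> exist, so this holds almost surely for all of them at once, and
  one may then substitute the random index \<open>b = \<psi> (n + N - 1)\<close>. Since conditional probabilities
  are at most \<open>1\<close>, dropping the first \<open>n - 1\<close> terms of the divergent sum leaves at least \<open>N\<close>.
\<close>

text \<open>The facts about \<open>real_cond_exp\<close> live in this locale; a probability measure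
  restricted to a sub-\<sigma>-algebra is still finite, hence \<sigma>-finite.\<close>

lemma sigma_finite_subalgebra_prob:
  assumes "prob_space M" "subalgebra M F"
  shows "sigma_finite_subalgebra M F"
proof -
  interpret prob_space M by fact
  interpret finite_measure_subalgebra M F
    using assms(2) by unfold_locales
  show ?thesis by unfold_locales
qed

lemma cond_prob_versions_AE:
  assumes "cond_prob_versions M F Q" "B \<in> sets M"
  shows "AE \<omega> in M. Q B \<omega> = real_cond_exp M F (indicator B) \<omega>"
  using assms by (simp add: cond_prob_versions_def)

lemma cond_prob_AE_nonneg:
  assumes "prob_space M" "subalgebra M F" "cond_prob_versions M F Q" "B \<in> sets M"
  shows "AE \<omega> in M. 0 \<le> Q B \<omega>"
proof -
  interpret sigma_finite_subalgebra M F
    using assms(1,2) by (rule sigma_finite_subalgebra_prob)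
  have "AE \<omega> in M. 0 \<le> real_cond_exp M F (indicator B) \<omega>"
    using assms(4) by (intro real_cond_exp_pos) auto
  with cond_prob_versions_AE[OF assms(3,4)] show ?thesis
    by eventually_elim simp
qed

lemma cond_prob_AE_space:
  assumes "prob_space M" "subalgebra M F" "cond_prob_versions M F Q"
  shows "AE \<omega> in M. Q (space M) \<omega> = 1"
proof -
  interpret prob_space M by fact
  interpret S: sigma_finite_subalgebra M F
    using assms(1,2) by (rule sigma_finite_subalgebra_prob)
  \<comment> \<open>A subalgebra has the same space, so the indicator is \<open>F\<close>-measurable
    and is its own conditional expectation.\<close>
  have ind: "indicator (space M) \<in> borel_measurable F"
    using assms(2) by (metis borel_measurable_indicator sets.top subalgebra_def)
  have "AE \<omega> in M. real_cond_exp M F (indicator (space M)) \<omega> = indicator (space M) \<omega>"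
    by (intro S.real_cond_exp_F_meas[OF _ ind] integrable_real_indicator)
       (simp_all add: emeasure_eq_measure)
  with cond_prob_versions_AE[OF assms(3) sets.top] AE_space show ?thesis
    by eventually_elim simp
qed

lemma cond_prob_AE_Diff:
  assumes "prob_space M" "subalgebra M F" "cond_prob_versions M F Q"
    and "B \<in> sets M" "C \<in> sets M"
  shows "AE \<omega> in M. Q (B - C) \<omega> = Q B \<omega> - Q (B \<inter> C) \<omega>"
proof -
  interpret prob_space M by fact
  interpret S: sigma_finite_subalgebra M F
    using assms(1,2) by (rule sigma_finite_subalgebra_prob)
  have meas: "B \<inter> C \<in> sets M" "B - C \<in> sets M"
    using assms(4,5) by auto
  have ind: "(indicator (B - C) :: 'a \<Rightarrow> real) = (\<lambda>\<omega>. indicator B \<omega> - indicator (B \<inter> C) \<omega>)"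
    by (auto simp: fun_eq_iff indicator_def)
  have "AE \<omega> in M. real_cond_exp M F (indicator (B - C)) \<omega> =
      real_cond_exp M F (indicator B) \<omega> - real_cond_exp M F (indicator (B \<inter> C)) \<omega>"
    unfolding ind using assms(4) meas(1)
    by (intro S.real_cond_exp_diff integrable_real_indicator) (simp_all add: emeasure_eq_measure)
  with cond_prob_versions_AE[OF assms(3,4)] cond_prob_versions_AE[OF assms(3) meas(1)]
    cond_prob_versions_AE[OF assms(3) meas(2)]
  show ?thesis by eventually_elim simp
qed

text \<open>The complement of \<open>B\<close> has nonnegative conditional probability, and that is
  \<open>1 - Q B\<close> almost surely.\<close>

lemma cond_prob_AE_le_1:
  assumes "prob_space M" "subalgebra M F" "cond_prob_versions M F Q" "B \<in> sets M"
  shows "AE \<omega> in M. Q B \<omega> \<le> 1"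
proof -
  have eq: "space M \<inter> B = B"
    using assms(4) by (simp add: sets.Int_space_eq1)
  have "AE \<omega> in M. Q (space M - B) \<omega> = Q (space M) \<omega> - Q B \<omega>"
    using cond_prob_AE_Diff[OF assms(1-3) sets.top assms(4)] by (simp only: eq)
  with cond_prob_AE_space[OF assms(1-3)]
    cond_prob_AE_nonneg[OF assms(1-3) sets.compl_sets[OF assms(4)]]
  show ?thesis by eventually_elim simp
qed

text \<open>Allowing both required events \<open>I\<close> and excluded events \<open>K\<close>
  makes the induction on \<open>K\<close> close: excluding one more \<open>A k\<close> subtracts the
  event in which \<open>k\<close> has joined \<open>I\<close>. Hence \<open>I\<close> must stay
  arbitrary.\<close>

lemma cond_indep_events_complements:
  assumes "prob_space M" "subalgebra M F" "cond_prob_versions M F Q"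
    and "\<And>i. i \<in> J \<Longrightarrow> A i \<in> sets M" "cond_indep_events M Q A J"
    and "finite K" "finite I" "K \<subseteq> J" "I \<subseteq> J" "I \<inter> K = {}"
  shows "AE \<omega> in M. Q ((space M \<inter> (\<Inter>i\<in>I. A i)) - (\<Union>k\<in>K. A k)) \<omega> =
    (\<Prod>i\<in>I. Q (A i) \<omega>) * (\<Prod>k\<in>K. 1 - Q (A k) \<omega>)"
  using assms(6-10)
proof (induction K arbitrary: I rule: finite_induct)
  case empty
  then show ?case
    using assms(5) by (simp add: cond_indep_events_def)
next
  case (insert k K)
  let ?B = "\<lambda>I. (space M \<inter> (\<Inter>i\<in>I. A i)) - (\<Union>k\<in>K. A k)"
  have kI: "k \<notin> I" using insert.prems by auto
  have Ak: "A k \<in> sets M" using insert.prems assms(4) by auto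
  have "space M \<inter> (\<Inter>i\<in>I. A i) \<in> sets M"
  \<comment> \<open>An empty intersection is \<open>UNIV\<close>, which need not be measurable;
    cutting it with \<open>space M\<close> repairs this case.\<close>
  proof (cases "I = {}")
    case False
    then have "(\<Inter>i\<in>I. A i) \<in> sets M"
      using insert.prems assms(4) by (intro sets.finite_INT) auto
    then show ?thesis by blast
  qed simp
  moreover have "(\<Union>k\<in>K. A k) \<in> sets M"
    using insert.prems insert.hyps assms(4) by (intro sets.finite_UN) auto
  ultimately have BI: "?B I \<in> sets M" by blast
  have eqs: "(space M \<inter> (\<Inter>i\<in>I. A i)) - (\<Union>k\<in>insert k K. A k) = ?B I - A k"
    "?B I \<inter> A k = ?B (insert k I)"
    by auto
  have "AE \<omega> in M. Q (?B I) \<omega> = (\<Prod>i\<in>I. Q (A i) \<omega>) * (\<Prod>k\<in>K. 1 - Q (A k) \<omega>)"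
    using insert.prems by (intro insert.IH) auto
  moreover have "AE \<omega> in M. Q (?B (insert k I)) \<omega> =
      (\<Prod>i\<in>insert k I. Q (A i) \<omega>) * (\<Prod>k\<in>K. 1 - Q (A k) \<omega>)"
    using insert.prems insert.hyps by (intro insert.IH) auto
  moreover have "AE \<omega> in M. Q (?B I - A k) \<omega> = Q (?B I) \<omega> - Q (?B (insert k I)) \<omega>"
    using cond_prob_AE_Diff[OF assms(1-3) BI Ak] by (simp only: eqs)
  ultimately show ?case
    unfolding eqs(1)
  \<comment> \<open>Since \<open>k\<close> lies in neither \<open>I\<close> nor \<open>K\<close>,
    both inserted products split, and the difference factors through
    \<open>1 - Q (A k) \<omega>\<close>.\<close>
  proof eventually_elim
    case (elim \<omega>)
    then show ?case
      using insert.hyps insert.prems(1) kI by (simp add: algebra_simps)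
  qed
qed

lemma cond_prob_AE_UN:
  assumes "prob_space M" "subalgebra M F" "cond_prob_versions M F Q"
    and "\<And>i. i \<in> J \<Longrightarrow> A i \<in> sets M" "cond_indep_events M Q A J" "finite K" "K \<subseteq> J"
  shows "AE \<omega> in M. Q (\<Union>k\<in>K. A k) \<omega> = 1 - (\<Prod>k\<in>K. 1 - Q (A k) \<omega>)"
proof -
  have U: "(\<Union>k\<in>K. A k) \<in> sets M"
    using assms by (intro sets.finite_UN) auto
  have eq: "space M \<inter> (\<Union>k\<in>K. A k) = (\<Union>k\<in>K. A k)"
    using sets.Int_space_eq1[OF U] .
  have "AE \<omega> in M. Q (space M - (\<Union>k\<in>K. A k)) \<omega> = (\<Prod>k\<in>K. 1 - Q (A k) \<omega>)"
    \<comment> \<open>With nothing required to occur, the intersection is the sure event and the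
      first product is 1.\<close>
    using cond_indep_events_complements[OF assms(1-6), of "{}"] assms(7) by simp
  moreover have "AE \<omega> in M. Q (space M - (\<Union>k\<in>K. A k)) \<omega> =
      Q (space M) \<omega> - Q (\<Union>k\<in>K. A k) \<omega>"
    using cond_prob_AE_Diff[OF assms(1-3) sets.top U] by (simp only: eq)
  ultimately show ?thesis
    using cond_prob_AE_space[OF assms(1-3)] by eventually_elim simp
qed

text \<open>Termwise this is \<open>1 - x \<le> exp (- x)\<close>; the bound
  \<open>f i \<le> 1\<close> keeps the factors nonnegative, so the inequalities may be multiplied.
  For infinite \<open>K\<close> both sides are 1 by the default values of product and sum.\<close>

lemma prod_one_minus_le_exp:
  fixes f :: "'i \<Rightarrow> real"
  assumes "\<And>i. i \<in> K \<Longrightarrow> f i \<le> 1"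
  shows "(\<Prod>i\<in>K. 1 - f i) \<le> exp (- (\<Sum>i\<in>K. f i))"
proof (cases "finite K")
  case True
  have "(\<Prod>i\<in>K. 1 - f i) \<le> (\<Prod>i\<in>K. exp (- f i))"
  proof (intro prod_mono conjI)
    fix i assume "i \<in> K"
    then show "0 \<le> 1 - f i" using assms by simp
    show "1 - f i \<le> exp (- f i)" using exp_ge_add_one_self[of "- f i"] by simp
  qed
  with True show ?thesis by (simp add: exp_sum flip: sum_negf)
qed simp

lemma sum_tail_ge:
  fixes f :: "nat \<Rightarrow> real"
  assumes "\<And>i. i \<ge> 1 \<Longrightarrow> 0 \<le> f i" "\<And>i. i \<ge> 1 \<Longrightarrow> f i \<le> 1" "n \<ge> 1"
    and "(\<Sum>i = 1..b. f i) \<ge> real (n + N - 1)"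
  shows "(\<Sum>i = n..b. f i) \<ge> real N"
proof -
  \<comment> \<open>Only an inequality, because \<open>b\<close> may be smaller than
    \<open>n - 1\<close>; the extra terms are nonnegative.\<close>
  have "(\<Sum>i = 1..b. f i) \<le> (\<Sum>i \<in> {1..<n} \<union> {n..b}. f i)"
    using assms(1,3) by (intro sum_mono2) auto
  also have "\<dots> = (\<Sum>i = 1..<n. f i) + (\<Sum>i = n..b. f i)"
    by (intro sum.union_disjoint) auto
  also have "(\<Sum>i = 1..<n. f i) \<le> real (n - 1)"
    using sum_bounded_above[of "{1..<n}" f 1] assms(2) by simp
  finally show ?thesis using assms(3,4) by (simp add: of_nat_diff)
qed

theorem theorem3p4:
  fixes M F :: "'a measure"
    and Q :: "'a set \<Rightarrow> 'a \<Rightarrow> real"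
    and A :: "nat \<Rightarrow> 'a set"
    and \<psi> :: "nat \<Rightarrow> 'a \<Rightarrow> nat"
  assumes "prob_space M"
    and "subalgebra M F"
    and "cond_prob_versions M F Q"
    and "\<And>n. n \<ge> 1 \<Longrightarrow> A n \<in> sets M"
    and "cond_indep_events M Q A {1..}"
    and "\<And>N \<omega>. N \<ge> 1 \<Longrightarrow> \<omega> \<in> space M \<Longrightarrow> \<psi> N \<omega> \<ge> 1"
    and "AE_diverges_with_rate M (\<lambda>i. Q (A i)) \<psi>"
  shows "\<forall>n\<ge>1. \<forall>N\<ge>1. AE \<omega> in M.
    Q (\<Union>i\<in>{n..\<psi> (n + N - 1) \<omega>}. A i) \<omega> \<ge> 1 - exp (- real N)"
proof (intro allI impI)
  fix n N :: nat
  assume n: "n \<ge> 1" and N: "N \<ge> 1"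
  let ?m = "n + N - 1"
  have "AE \<omega> in M. \<forall>b. Q (\<Union>i\<in>{n..b}. A i) \<omega> = 1 - (\<Prod>i = n..b. 1 - Q (A i) \<omega>)"
    unfolding AE_all_countable
    using n assms(4) by (intro allI cond_prob_AE_UN[OF assms(1-3) _ assms(5)]) auto
  moreover have "AE \<omega> in M. \<forall>i. i \<ge> 1 \<longrightarrow> 0 \<le> Q (A i) \<omega>"
    unfolding AE_all_countable using cond_prob_AE_nonneg[OF assms(1-3)] assms(4) by simp
  moreover have "AE \<omega> in M. \<forall>i. i \<ge> 1 \<longrightarrow> Q (A i) \<omega> \<le> 1"
    unfolding AE_all_countable using cond_prob_AE_le_1[OF assms(1-3)] assms(4) by simp
  \<comment> \<open>The rate is used at \<open>n + N - 1\<close>: giving up at most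
    \<open>n - 1\<close> for the initial terms leaves exactly the required \<open>N\<close>.\<close>
  moreover have "AE \<omega> in M. (\<Sum>i = 1..\<psi> ?m \<omega>. Q (A i) \<omega>) \<ge> real ?m"
    using assms(7) n N unfolding AE_diverges_with_rate_def by (elim allE[of _ ?m]) auto
  ultimately show "AE \<omega> in M. Q (\<Union>i\<in>{n..\<psi> ?m \<omega>}. A i) \<omega> \<ge> 1 - exp (- real N)"
  proof eventually_elim
    case (elim \<omega>)
    have "(\<Prod>i = n..\<psi> ?m \<omega>. 1 - Q (A i) \<omega>) \<le> exp (- (\<Sum>i = n..\<psi> ?m \<omega>. Q (A i) \<omega>))"
      using elim(3) n by (intro prod_one_minus_le_exp) auto
    also have "\<dots> \<le> exp (- real N)"
      using sum_tail_ge[of "\<lambda>i. Q (A i) \<omega>" n N "\<psi> ?m \<omega>"] elim n by simp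
    finally show ?case using elim(1) by simp
  qed
qed

end
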